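(* Let $(X,\nu,\mathcal{T}_1,\tau_1)$ be a Type 1 computable topological space which satisfies the Markov condition with respect to effective closure, i.e. $$\forall x\in X,\ \forall A\subseteq X,\ \big(x\notin A\ \&\ x\in\overline{A}^{+}\big)\implies A\rightsquigarrow_\nu\{x\},$$ and which satisfies the identification condition between the closure and the effective closure for semi-decidable sets, i.e. $\overline{A}=\overline{A}^{+}$ for every $\nu$-semi-decidable $A\subseteq X$ (where $\overline{A}$ is the closure in $\mathcal{T}_1$). Let $(Y,\mu,\mathcal{T}_2,\tau_2)$ be a Type 1 computable topological space in which every point has an effective neighborhood basis of co-semi-decidable sets. Then every $(\nu,\mu)$-computable function $f:X\to Y$ is $(\mathcal{T}_1,\mathcal{T}_2)$-continuous.
   Context: A numbering of a set $X$ is a surjection $\nu$ from a subset $\mathrm{dom}(\nu)\subseteq\mathbb{N}$ onto $X$; a subnumbering of $X$ is a numbering of a subset of $X$. If $\nu(n)=x$, $n$ is a $\nu$-name of $x$. $\varphi_0,\varphi_1,\dots$ is a standard enumeration of the partial recursive functions. For numbered sets $(X,\nu),(Y,\mu)$, a map $f:X\to Y$ is $(\nu,\mu)$-computable if there is a partial computable $F$ defined on $\mathrm{dom}(\nu)$ with $\mu(F(n))=f(\nu(n))$ for all $n\in\mathrm{dom}(\nu)$. A set $A\subseteq X$ is $\nu$-semi-decidable if there is $e$ with $\varphi_e(i)\downarrow\iff\nu(i)\in A$ for all $i\in\mathrm{dom}(\nu)$; such $e$ is a $\nu_{SD}$-name of $A$. A set is $\nu$-co-semi-decidable if its complement is $\nu$-semi-decidable.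 For $B\subseteq C\subseteq X$, $B$ is a $\nu$-semi-decidable subset of $C$ if there is $e$ such that for all $i\in\mathrm{dom}(\nu)$ with $\nu(i)\in C$: $\varphi_e(i)\downarrow\iff\nu(i)\in B$. One writes $A\rightsquigarrow_\nu B$ iff $B$ is not a $\nu$-semi-decidable subset of $A\cup B$. For subnumberings $\alpha,\beta$ of a set, $\alpha\le\beta$ means there is a partial computable $F$ defined on $\mathrm{dom}(\alpha)$ with $\beta(F(n))=\alpha(n)$. A Type 1 computable topological space is a quadruple $(X,\nu,\mathcal{T},\tau)$ where $\mathcal{T}$ is a topology on $X$, $\nu$ a numbering of $X$, $\tau$ a subnumbering of $\mathcal{T}$, such that: the image of $\tau$ generates $\mathcal{T}$ as a basis; $\emptyset$ and $X$ are in the image of $\tau$; $\tau\le\nu_{SD}$ (from a $\tau$-name of $O$ one computes a $\nu_{SD}$-name of $O$); there is a computable procedure which, given an index of a total computable $g$ with values in $\mathrm{dom}(\tau)$, outputs a $\tau$-name of $\bigcup_n\tau(g(n))$; and there is a computable procedure which from $\tau$-names of $O_1,O_2$ outputs a $\tau$-name of $O_1\cap O_2$. Sets in the image of $\tau$ are the effective open sets. For $A\subseteq X$, a point $x$ is effectively adherent to $A$, written $x\in\overline{A}^{+}$, if there is a partial computable function which, on input any $\tau$-name of an open set $O$ containing $x$, outputs a $\nu$-name of a point of $O\cap A$. For $x\in X$, let $\mathfrak{n}_x$ be the multi-numbering of neighborhoods of $x$: its names are the $\tau$-names $n$ with $x\in\tau(n)$, and $n$ names every set $A\supseteq\tau(n)$.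 An effective neighborhood basis of $x$ is a pair $(\mathcal{B}_x,\beta_x)$ with $\mathcal{B}_x$ a neighborhood basis of $x$ and $\beta_x$ a numbering of $\mathcal{B}_x$, such that there is a computable procedure which, given any $\mathfrak{n}_x$-name $n$, produces a $\beta_x$-name of some $B\in\mathcal{B}_x$ with $B\subseteq\tau(n)$. The point $x$ has an effective neighborhood basis of co-semi-decidable sets if there is such a pair in which every $\beta_x(n)$ is $\mu$-co-semi-decidable (with $\mu$ the numbering of the space). *)

theory Defs
  imports "HOL-Analysis.Abstract_Topology" "HOL-Library.Nat_Bijection"
begin

section \<open>Partial recursive functions\<close>

text \<open>
  Kleene's schemes, acting on argument lists of arbitrary length. Arities are not tracked: on
  lists of any fixed length each scheme is the usual one, except that a projection out of
  range, and the successor or a recursion applied to the empty list, are undefined.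
\<close>

datatype recf =
  Zero | Succ | Proj nat | Comp recf "recf list" | PrimRec recf recf | Mu recf

definition comp_scheme ::
  "(nat list \<rightharpoonup> nat) \<Rightarrow> (nat list \<rightharpoonup> nat) list \<Rightarrow> nat list \<rightharpoonup> nat" where
  "comp_scheme F Gs xs =
     (if \<forall>G\<in>set Gs. G xs \<noteq> None then F (map (\<lambda>G. the (G xs)) Gs) else None)"

fun primrec_scheme ::
  "(nat list \<rightharpoonup> nat) \<Rightarrow> (nat list \<rightharpoonup> nat) \<Rightarrow> nat list \<rightharpoonup> nat" where
  "primrec_scheme F G [] = None"
| "primrec_scheme F G (0 # xs) = F xs"
| "primrec_scheme F G (Suc n # xs) =
     Option.bind (primrec_scheme F G (n # xs)) (\<lambda>v. G (n # v # xs))"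

definition mu_scheme :: "(nat list \<rightharpoonup> nat) \<Rightarrow> nat list \<rightharpoonup> nat" where
  "mu_scheme F xs =
     (let stops = (\<lambda>n. F (n # xs) = Some 0 \<and> (\<forall>m<n. \<exists>v>0. F (m # xs) = Some v))
      in if \<exists>n. stops n then Some (LEAST n. stops n) else None)"

primrec recf_eval :: "recf \<Rightarrow> nat list \<rightharpoonup> nat" where
  "recf_eval Zero = (\<lambda>xs. Some 0)"
| "recf_eval Succ = (\<lambda>xs. case xs of [] \<Rightarrow> None | x # _ \<Rightarrow> Some (Suc x))"
| "recf_eval (Proj i) = (\<lambda>xs. if i < length xs then Some (xs ! i) else None)"
| "recf_eval (Comp f gs) = comp_scheme (recf_eval f) (map recf_eval gs)"
| "recf_eval (PrimRec f g) = primrec_scheme (recf_eval f) (recf_eval g)"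
| "recf_eval (Mu f) = mu_scheme (recf_eval f)"

primrec recf_code :: "recf \<Rightarrow> nat" where
  "recf_code Zero = prod_encode (0, 0)"
| "recf_code Succ = prod_encode (1, 0)"
| "recf_code (Proj i) = prod_encode (2, i)"
| "recf_code (Comp f gs) =
     prod_encode (3, prod_encode (recf_code f, list_encode (map recf_code gs)))"
| "recf_code (PrimRec f g) = prod_encode (4, prod_encode (recf_code f, recf_code g))"
| "recf_code (Mu f) = prod_encode (5, recf_code f)"

lemma recf_code_inject: "recf_code r = recf_code s \<Longrightarrow> r = s"
proof (induction r arbitrary: s)
  case (Comp f gs)
  then obtain f' gs' where s: "s = Comp f' gs'"
    by (cases s) auto
  with Comp.prems have eq: "recf_code f = recf_code f'" "map recf_code gs = map recf_code gs'"
    by (auto dest: list_encode_eq[THEN iffD1])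
  have "gs = gs'"
    using eq(2) Comp.IH(2) by (metis list.inj_map_strong)
  with eq(1) Comp.IH(1) s show ?case
    by simp
qed (case_tac s; simp)+

lemma inj_recf_code: "inj recf_code"
  by (rule injI) (rule recf_code_inject)

text \<open>
  The standard enumeration of the unary partial recursive functions. Numbers that are not codes
  of terms index the nowhere defined function.
\<close>

definition phi :: "nat \<Rightarrow> nat \<rightharpoonup> nat" where
  "phi e x = (if e \<in> range recf_code then recf_eval (inv recf_code e) [x] else None)"

lemma phi_recf_code: "phi (recf_code r) x = recf_eval r [x]"
  by (simp add: phi_def inv_f_f[OF inj_recf_code])

definition partial_computable :: "(nat \<rightharpoonup> nat) \<Rightarrow> bool" where
  "partial_computable F \<longleftrightarrow> (\<exists>e. F = phi e)"


section \<open>Numberings\<close>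

text \<open>
  A (sub)numbering is a partial function from the natural numbers, its names being the elements
  of its domain.
\<close>

definition numbering :: "(nat \<rightharpoonup> 'a) \<Rightarrow> 'a set \<Rightarrow> bool" where
  "numbering \<nu> X \<longleftrightarrow> ran \<nu> = X"

definition subnumbering :: "(nat \<rightharpoonup> 'a) \<Rightarrow> 'a set \<Rightarrow> bool" where
  "subnumbering \<nu> X \<longleftrightarrow> (\<exists>A\<subseteq>X. numbering \<nu> A)"

definition reducible :: "(nat \<rightharpoonup> 'a) \<Rightarrow> (nat \<rightharpoonup> 'a) \<Rightarrow> bool" where
  "reducible \<alpha> \<beta> \<longleftrightarrow>
     (\<exists>F. partial_computable F \<and>
          (\<forall>n x. \<alpha> n = Some x \<longrightarrow> (\<exists>m. F n = Some m \<and> \<beta> m = Some x)))"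

definition computable_map ::
  "(nat \<rightharpoonup> 'a) \<Rightarrow> (nat \<rightharpoonup> 'b) \<Rightarrow> ('a \<Rightarrow> 'b) \<Rightarrow> bool" where
  "computable_map \<nu> \<mu> f \<longleftrightarrow>
     (\<exists>F. partial_computable F \<and>
          (\<forall>n x. \<nu> n = Some x \<longrightarrow> (\<exists>m. F n = Some m \<and> \<mu> m = Some (f x))))"

text \<open>In the notions below \<open>ran \<nu>\<close> is the numbered set.\<close>

definition semidec_name :: "(nat \<rightharpoonup> 'a) \<Rightarrow> nat \<Rightarrow> 'a set \<Rightarrow> bool" where
  "semidec_name \<nu> e A \<longleftrightarrow>
     A \<subseteq> ran \<nu> \<and> (\<forall>i x. \<nu> i = Some x \<longrightarrow> (phi e i \<noteq> None \<longleftrightarrow> x \<in> A))"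

definition semidec_numbering :: "(nat \<rightharpoonup> 'a) \<Rightarrow> nat \<rightharpoonup> 'a set" where
  "semidec_numbering \<nu> e =
     (if \<exists>A. semidec_name \<nu> e A then Some (THE A. semidec_name \<nu> e A) else None)"

lemma semidec_name_unique:
  assumes "semidec_name \<nu> e A" "semidec_name \<nu> e B"
  shows "A = B"
  using assms unfolding semidec_name_def ran_def by blast

lemma semidec_numbering_eq_Some:
  "semidec_numbering \<nu> e = Some A \<longleftrightarrow> semidec_name \<nu> e A"
proof -
  have "(THE A. semidec_name \<nu> e A) = B" if "semidec_name \<nu> e B" for B
    by (rule the_equality) (use that semidec_name_unique in metis)+
  then show ?thesis
    unfolding semidec_numbering_def by auto
qed

definition semi_decidable :: "(nat \<rightharpoonup> 'a) \<Rightarrow> 'a set \<Rightarrow> bool" where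
  "semi_decidable \<nu> A \<longleftrightarrow> (\<exists>e. semidec_name \<nu> e A)"

definition co_semi_decidable :: "(nat \<rightharpoonup> 'a) \<Rightarrow> 'a set \<Rightarrow> bool" where
  "co_semi_decidable \<nu> A \<longleftrightarrow> A \<subseteq> ran \<nu> \<and> semi_decidable \<nu> (ran \<nu> - A)"

definition semi_decidable_subset :: "(nat \<rightharpoonup> 'a) \<Rightarrow> 'a set \<Rightarrow> 'a set \<Rightarrow> bool" where
  "semi_decidable_subset \<nu> B C \<longleftrightarrow>
     B \<subseteq> C \<and> C \<subseteq> ran \<nu> \<and>
     (\<exists>e. \<forall>i x. \<nu> i = Some x \<and> x \<in> C \<longrightarrow> (phi e i \<noteq> None \<longleftrightarrow> x \<in> B))"

definition leads_to :: "'a set \<Rightarrow> (nat \<rightharpoonup> 'a) \<Rightarrow> 'a set \<Rightarrow> bool"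
  (\<open>(_ \<leadsto>\<^sub>_ _)\<close> [51, 1000, 51] 50) where
  "A \<leadsto>\<^sub>\<nu> B \<longleftrightarrow> \<not> semi_decidable_subset \<nu> B (A \<union> B)"


section \<open>Type 1 computable topological spaces\<close>

text \<open>The underlying set is \<open>topspace T\<close>.\<close>

locale type1_computable_top_space =
  fixes \<nu> :: "nat \<rightharpoonup> 'a" and T :: "'a topology" and \<tau> :: "nat \<rightharpoonup> 'a set"
  assumes points: "numbering \<nu> (topspace T)"
    and opens: "subnumbering \<tau> {U. openin T U}"
    and basis: "openin T = arbitrary union_of (\<lambda>U. U \<in> ran \<tau>)"
    and empty_effective: "{} \<in> ran \<tau>"
    and space_effective: "topspace T \<in> ran \<tau>"
    and opens_semidec: "reducible \<tau> (semidec_numbering \<nu>)"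
    and effective_Union:
      "\<exists>F. partial_computable F \<and>
           (\<forall>e g. (\<forall>n. phi e n = Some (g n) \<and> g n \<in> dom \<tau>) \<longrightarrow>
                  (\<exists>m. F e = Some m \<and> \<tau> m = Some (\<Union>n. the (\<tau> (g n)))))"
    and effective_Int:
      "\<exists>F. partial_computable F \<and>
           (\<forall>a b U V. \<tau> a = Some U \<and> \<tau> b = Some V \<longrightarrow>
                      (\<exists>m. F (prod_encode (a, b)) = Some m \<and> \<tau> m = Some (U \<inter> V)))"

definition effective_closure ::
  "(nat \<rightharpoonup> 'a) \<Rightarrow> 'a topology \<Rightarrow> (nat \<rightharpoonup> 'a set) \<Rightarrow> 'a set \<Rightarrow> 'a set" where
  "effective_closure \<nu> T \<tau> A =
     {x \<in> topspace T.
        \<exists>F. partial_computable F \<and>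
            (\<forall>n U. \<tau> n = Some U \<and> x \<in> U \<longrightarrow>
                   (\<exists>m y. F n = Some m \<and> \<nu> m = Some y \<and> y \<in> U \<inter> A))}"

definition markov_condition ::
  "(nat \<rightharpoonup> 'a) \<Rightarrow> 'a topology \<Rightarrow> (nat \<rightharpoonup> 'a set) \<Rightarrow> bool" where
  "markov_condition \<nu> T \<tau> \<longleftrightarrow>
     (\<forall>x\<in>topspace T. \<forall>A\<subseteq>topspace T.
        x \<notin> A \<and> x \<in> effective_closure \<nu> T \<tau> A \<longrightarrow> A \<leadsto>\<^sub>\<nu> {x})"

definition closure_identification ::
  "(nat \<rightharpoonup> 'a) \<Rightarrow> 'a topology \<Rightarrow> (nat \<rightharpoonup> 'a set) \<Rightarrow> bool" where
  "closure_identification \<nu> T \<tau> \<longleftrightarrow>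
     (\<forall>A\<subseteq>topspace T. semi_decidable \<nu> A \<longrightarrow>
        T closure_of A = effective_closure \<nu> T \<tau> A)"

text \<open>Neighborhoods and the members of a neighborhood basis need not be open.\<close>

definition neighborhood :: "'a topology \<Rightarrow> 'a \<Rightarrow> 'a set \<Rightarrow> bool" where
  "neighborhood T x V \<longleftrightarrow> V \<subseteq> topspace T \<and> (\<exists>U. openin T U \<and> x \<in> U \<and> U \<subseteq> V)"

definition neighborhood_basis :: "'a topology \<Rightarrow> 'a \<Rightarrow> 'a set set \<Rightarrow> bool" where
  "neighborhood_basis T x \<B> \<longleftrightarrow>
     (\<forall>B\<in>\<B>. neighborhood T x B) \<and> (\<forall>V. neighborhood T x V \<longrightarrow> (\<exists>B\<in>\<B>. B \<subseteq> V))"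

definition neighborhood_name ::
  "'a topology \<Rightarrow> (nat \<rightharpoonup> 'a set) \<Rightarrow> 'a \<Rightarrow> nat \<Rightarrow> 'a set \<Rightarrow> bool" where
  "neighborhood_name T \<tau> x n A \<longleftrightarrow>
     A \<subseteq> topspace T \<and> (\<exists>U. \<tau> n = Some U \<and> x \<in> U \<and> U \<subseteq> A)"

definition effective_neighborhood_basis ::
  "'a topology \<Rightarrow> (nat \<rightharpoonup> 'a set) \<Rightarrow> 'a \<Rightarrow> 'a set set \<Rightarrow> (nat \<rightharpoonup> 'a set) \<Rightarrow> bool" where
  "effective_neighborhood_basis T \<tau> x \<B> \<beta> \<longleftrightarrow>
     neighborhood_basis T x \<B> \<and> numbering \<beta> \<B> \<and>
     (\<exists>F. partial_computable F \<and>
          (\<forall>n. (\<exists>A. neighborhood_name T \<tau> x n A) \<longrightarrow>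
               (\<exists>m B. F n = Some m \<and> \<beta> m = Some B \<and> B \<subseteq> the (\<tau> n))))"

definition has_co_semi_decidable_basis ::
  "(nat \<rightharpoonup> 'a) \<Rightarrow> 'a topology \<Rightarrow> (nat \<rightharpoonup> 'a set) \<Rightarrow> 'a \<Rightarrow> bool" where
  "has_co_semi_decidable_basis \<mu> T \<tau> x \<longleftrightarrow>
     (\<exists>\<B> \<beta>. effective_neighborhood_basis T \<tau> x \<B> \<beta> \<and>
            (\<forall>n B. \<beta> n = Some B \<longrightarrow> co_semi_decidable \<mu> B))"

end

(*
  Fix a point x and a co-semi-decidable neighbourhood B of f(x) inside a given open set. The set A
  of points that f sends outside B is semi-decidable, and it does not accumulate at x: otherwise x
  would be effectively adherent to A, whereas a basic open set O with f(x) in O and O inside B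
  has a semi-decidable preimage that contains x and misses A, against the Markov condition.
  So the complement of the closure of A is a neighbourhood of x that f sends into B.
*)
theory Submission
  imports Defs
begin

lemma partial_computable_comp:
  assumes "partial_computable F" "partial_computable G"
  shows "partial_computable (F \<circ>\<^sub>m G)"
proof -
  have recf: "\<exists>r. \<forall>x. H x = recf_eval r [x]" if H: "partial_computable H" for H
  proof -
    obtain e where e: "H = phi e"
      using H by (auto simp: partial_computable_def)
    show ?thesis
    proof (cases "e \<in> range recf_code")
      case True
      then show ?thesis
        using e phi_recf_code by blast
    next
      case False
      \<comment> \<open>A number that codes no term indexes the nowhere defined function. The term
        \<open>Proj 1\<close> realises it, being out of range on the one-element list
        \<open>[x]\<close>.\<close>
      then have "H x = recf_eval (Proj 1) [x]" for x
        by (simp add: e phi_def)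
      then show ?thesis by blast
    qed
  qed
  obtain r s where "\<And>x. F x = recf_eval r [x]" "\<And>x. G x = recf_eval s [x]"
    using recf[OF assms(1)] recf[OF assms(2)] by blast
  then have "F \<circ>\<^sub>m G = phi (recf_code (Comp r [s]))"
    by (intro ext) (auto simp: phi_recf_code comp_scheme_def map_comp_def
        simp del: recf_code.simps split: option.split)
  then show ?thesis
    by (auto simp: partial_computable_def)
qed

text \<open>A realiser \<open>F\<close> of \<open>f\<close> turns a \<open>\<nu>\<close>-name of a
  point into a \<open>\<mu>\<close>-name of its image, so running the procedure for \<open>V\<close>
  after \<open>F\<close> semi-decides the preimage.\<close>

lemma semi_decidable_vimage:
  assumes f: "computable_map \<nu> \<mu> f" and V: "semi_decidable \<mu> V"
  shows "semi_decidable \<nu> {x \<in> ran \<nu>. f x \<in> V}"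
proof -
  obtain F where F: "partial_computable F"
    and Fname: "\<And>n x. \<nu> n = Some x \<Longrightarrow> \<exists>m. F n = Some m \<and> \<mu> m = Some (f x)"
    using f unfolding computable_map_def by blast
  obtain d where d: "\<And>i y. \<mu> i = Some y \<Longrightarrow> phi d i \<noteq> None \<longleftrightarrow> y \<in> V"
    using V unfolding semi_decidable_def semidec_name_def by blast
  obtain e where e: "phi d \<circ>\<^sub>m F = phi e"
    using partial_computable_comp[OF _ F, of "phi d"] unfolding partial_computable_def by blast
  have "phi e i \<noteq> None \<longleftrightarrow> f x \<in> V" if "\<nu> i = Some x" for i x
  proof -
    obtain m where "F i = Some m" "\<mu> m = Some (f x)"
      using Fname \<open>\<nu> i = Some x\<close> by blast
    then show ?thesis
      using d[of m] by (simp flip: e)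
  qed
  then have "semidec_name \<nu> e {x \<in> ran \<nu>. f x \<in> V}"
    by (auto simp: semidec_name_def intro: ranI)
  then show ?thesis
    by (auto simp: semi_decidable_def)
qed

lemma (in type1_computable_top_space) ran_points: "ran \<nu> = topspace T"
  using points by (simp add: numbering_def)

lemma (in type1_computable_top_space) semi_decidable_effective_open:
  "U \<in> ran \<tau> \<Longrightarrow> semi_decidable \<nu> U"
  using opens_semidec
  by (fastforce simp: reducible_def semi_decidable_def semidec_numbering_eq_Some ran_def)

lemma (in type1_computable_top_space) effective_open_between:
  assumes "neighborhood T x V"
  obtains U where "U \<in> ran \<tau>" "x \<in> U" "U \<subseteq> V"
proof -
  obtain W where "openin T W" "x \<in> W" "W \<subseteq> V"
    using assms by (auto simp: neighborhood_def)
  then obtain \<U> where "\<U> \<subseteq> ran \<tau>" "\<Union>\<U> = W"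
    by (auto simp: basis union_of_def arbitrary_def)
  with \<open>x \<in> W\<close> \<open>W \<subseteq> V\<close> that show ?thesis
    by blast
qed

text \<open>Within \<open>A \<union> B\<close> the set \<open>W\<close> has exactly the points of
  \<open>B\<close>, so a procedure for \<open>W\<close> also singles out \<open>B\<close> there.
  This is the form in which the Markov condition gets contradicted.\<close>

lemma separated_not_leads_to:
  assumes "semi_decidable \<nu> W" "B \<subseteq> W" "A \<inter> W = {}" "A \<subseteq> ran \<nu>"
  shows "\<not> A \<leadsto>\<^sub>\<nu> B"
proof -
  obtain e where "W \<subseteq> ran \<nu>" and e: "\<And>i x. \<nu> i = Some x \<Longrightarrow> phi e i \<noteq> None \<longleftrightarrow> x \<in> W"
    using assms(1) unfolding semi_decidable_def semidec_name_def by blast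
  have "phi e i \<noteq> None \<longleftrightarrow> x \<in> B" if "\<nu> i = Some x" "x \<in> A \<union> B" for i x
    using e[OF that(1)] that(2) assms(2,3) by blast
  then show ?thesis
    unfolding leads_to_def semi_decidable_subset_def
    using assms(2,4) \<open>W \<subseteq> ran \<nu>\<close> by blast
qed

text \<open>Since \<open>\<beta>\<close> is onto the basis, every member has a name, and so the
  property assumed of all named sets holds for a member chosen inside \<open>V\<close>.\<close>

lemma co_semi_decidable_neighborhood_within:
  assumes "has_co_semi_decidable_basis \<mu> T \<tau> y" "neighborhood T y V"
  obtains B where "neighborhood T y B" "B \<subseteq> V" "co_semi_decidable \<mu> B"
proof -
  obtain \<B> \<beta> where basis: "effective_neighborhood_basis T \<tau> y \<B> \<beta>"
    and "\<forall>n B. \<beta> n = Some B \<longrightarrow> co_semi_decidable \<mu> B"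
    using assms(1) unfolding has_co_semi_decidable_basis_def by blast
  moreover from basis have "neighborhood_basis T y \<B>" "ran \<beta> = \<B>"
    by (simp_all add: effective_neighborhood_basis_def numbering_def)
  moreover from this(1) assms(2) obtain B where "B \<in> \<B>" "B \<subseteq> V" "neighborhood T y B"
    unfolding neighborhood_basis_def by blast
  ultimately show ?thesis
    using that by (auto simp: ran_def)
qed

theorem mainTheorem1:
  fixes \<nu> :: "nat \<rightharpoonup> 'a" and T1 :: "'a topology" and \<tau>1 :: "nat \<rightharpoonup> 'a set"
    and \<mu> :: "nat \<rightharpoonup> 'b" and T2 :: "'b topology" and \<tau>2 :: "nat \<rightharpoonup> 'b set"
    and f :: "'a \<Rightarrow> 'b"
  assumes "type1_computable_top_space \<nu> T1 \<tau>1"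
    and "markov_condition \<nu> T1 \<tau>1"
    and "closure_identification \<nu> T1 \<tau>1"
    and "type1_computable_top_space \<mu> T2 \<tau>2"
    and "\<forall>y\<in>topspace T2. has_co_semi_decidable_basis \<mu> T2 \<tau>2 y"
    and "f \<in> topspace T1 \<rightarrow> topspace T2"
    and "computable_map \<nu> \<mu> f"
  shows "continuous_map T1 T2 f"
proof -
  interpret X: type1_computable_top_space \<nu> T1 \<tau>1 by fact
  interpret Y: type1_computable_top_space \<mu> T2 \<tau>2 by fact
  have "\<exists>N. openin T1 N \<and> x \<in> N \<and> N \<subseteq> {x \<in> topspace T1. f x \<in> V}"
    if V: "openin T2 V" and x: "x \<in> topspace T1" and fx: "f x \<in> V" for V x
  proof -
    have "has_co_semi_decidable_basis \<mu> T2 \<tau>2 (f x)"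
      using x assms(5,6) by auto
    moreover have "neighborhood T2 (f x) V"
      using V fx by (auto simp: neighborhood_def openin_subset)
    ultimately obtain B where B: "neighborhood T2 (f x) B" "B \<subseteq> V" "co_semi_decidable \<mu> B"
      by (rule co_semi_decidable_neighborhood_within)
    \<comment> \<open>\<open>B\<close> itself need be neither open nor semi-decidable; the effective
      open set \<open>U\<close> inside it is both.\<close>
    obtain U where U: "U \<in> ran \<tau>2" "f x \<in> U" "U \<subseteq> B"
      using Y.effective_open_between[OF B(1)] by blast
    define A where "A = {z \<in> ran \<nu>. f z \<in> ran \<mu> - B}"
    define W where "W = {z \<in> ran \<nu>. f z \<in> U}"
    have A: "semi_decidable \<nu> A" "A \<subseteq> topspace T1"
      using semi_decidable_vimage[OF assms(7), of "ran \<mu> - B"] B(3)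
      by (auto simp: A_def X.ran_points co_semi_decidable_def)
    have "semi_decidable \<nu> W"
      unfolding W_def by (intro semi_decidable_vimage[OF assms(7)] Y.semi_decidable_effective_open U)
    \<comment> \<open>\<open>W\<close> contains \<open>x\<close> because \<open>f x\<close> lies in
      \<open>U\<close>, and it misses \<open>A\<close> because \<open>U\<close> lies inside
      \<open>B\<close>.\<close>
    then have "\<not> A \<leadsto>\<^sub>\<nu> {x}"
      by (rule separated_not_leads_to)
        (use U x in \<open>auto simp: A_def W_def X.ran_points\<close>)
    moreover have "x \<notin> A"
      using U by (auto simp: A_def)
    ultimately have "x \<notin> effective_closure \<nu> T1 \<tau>1 A"
      using assms(2) x A by (auto simp: markov_condition_def)
    \<comment> \<open>Semi-decidability of \<open>A\<close> allows the effective closure to be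
      replaced by the topological one.\<close>
    then have "x \<notin> T1 closure_of A"
      using assms(3) A by (simp add: closure_identification_def)
    \<comment> \<open>A point outside the closure is outside \<open>A\<close>. Its image lies in
      \<open>topspace T2\<close>, which is \<open>ran \<mu>\<close>, and hence in
      \<open>B\<close>.\<close>
    moreover have "topspace T1 - T1 closure_of A \<subseteq> {x \<in> topspace T1. f x \<in> V}"
      using closure_of_subset[OF A(2)] B(2) assms(6)
      by (auto simp: A_def X.ran_points Y.ran_points)
    ultimately show ?thesis
      using x by (intro exI[of _ "topspace T1 - T1 closure_of A"]) auto
  qed
  then have "openin T1 {x \<in> topspace T1. f x \<in> V}" if "openin T2 V" for V
    using that by (subst openin_subopen) blast
  then show ?thesis
    using assms(6) by (simp add: continuous_map_def)
qed

end
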